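(* Let $\mathfrak{g}$ be the 7-dimensional real nilpotent Lie algebra whose dual $\mathfrak{g}^*$ has a basis $\{e^1,\dots,e^7\}$ with $de^1=de^2=0$, $de^3=e^{12}$, $de^4=e^{13}$, $de^5=e^{14}$, $de^6=e^{15}+e^{23}$, $de^7=e^{16}+e^{23}+e^{24}$. Then $\mathfrak{g}$ has an Einstein pseudo-metric $g$ with nonzero scalar curvature.
   Context: Here $d$ is the Chevalley–Eilenberg differential on $\mathfrak{g}^*$, given by $d\alpha(x,y)=-\alpha([x,y])$ for $\alpha\in\mathfrak{g}^*$, and $e^{ij}$ stands for $e^i\wedge e^j$. A pseudo-metric on a Lie algebra is a nondegenerate symmetric bilinear form (scalar product, of any signature) on it; it is identified with the corresponding left-invariant pseudo-Riemannian metric on the associated simply connected Lie group, and its Ricci curvature and scalar curvature are those of that metric (evaluated on left-invariant vector fields). A pseudo-metric $g$ is Einstein if $\mathrm{Ric}(g)=\lambda g$ for some real constant $\lambda$; it is Ricci-flat if $\lambda=0$, and Einstein of nonzero scalar curvature (non Ricci-flat Einstein) if $\lambda\neq 0$. *)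

theory Defs
  imports "HOL-Analysis.Analysis"
begin

subsection \<open>Lie algebras and the Chevalley--Eilenberg differential\<close>

text \<open>The underlying vector space is a type of class \<open>real_vector\<close>; the bracket is an explicit
  argument \<open>br\<close>.\<close>

definition lie_algebra :: "('a::real_vector \<Rightarrow> 'a \<Rightarrow> 'a) \<Rightarrow> bool" where
  "lie_algebra br \<longleftrightarrow> bilinear br \<and> (\<forall>x. br x x = 0) \<and>
    (\<forall>x y z. br x (br y z) + br y (br z x) + br z (br x y) = 0)"

primrec lower_central :: "('a::real_vector \<Rightarrow> 'a \<Rightarrow> 'a) \<Rightarrow> nat \<Rightarrow> 'a set" where
  "lower_central br 0 = UNIV"
| "lower_central br (Suc k) = span {br x y | x y. y \<in> lower_central br k}"

definition nilpotent_lie_algebra :: "('a::real_vector \<Rightarrow> 'a \<Rightarrow> 'a) \<Rightarrow> bool" where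
  "nilpotent_lie_algebra br \<longleftrightarrow> lie_algebra br \<and> (\<exists>k. lower_central br k = {0})"

text \<open>\<open>e 1, \<dots>, e n\<close> is a basis of the dual space (the space of linear functionals).\<close>

definition dual_space_basis :: "nat \<Rightarrow> (nat \<Rightarrow> 'a::real_vector \<Rightarrow> real) \<Rightarrow> bool" where
  "dual_space_basis n e \<longleftrightarrow>
    (\<forall>i\<in>{1..n}. linear (e i)) \<and>
    (\<forall>\<alpha>. linear \<alpha> \<longrightarrow> (\<exists>c. \<alpha> = (\<lambda>x. \<Sum>i=1..n. c i * e i x))) \<and>
    (\<forall>c. (\<lambda>x. \<Sum>i=1..n. c i * e i x) = (\<lambda>x. 0) \<longrightarrow> (\<forall>i\<in>{1..n}. c i = 0))"

definition ce_diff :: "('a::real_vector \<Rightarrow> 'a \<Rightarrow> 'a) \<Rightarrow> ('a \<Rightarrow> real) \<Rightarrow> 'a \<Rightarrow> 'a \<Rightarrow> real" where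
  "ce_diff br \<alpha> = (\<lambda>x y. - \<alpha> (br x y))"

text \<open>The wedge product of 1-forms is normalised without the factor 1/2.\<close>

definition wedge :: "('a \<Rightarrow> real) \<Rightarrow> ('a \<Rightarrow> real) \<Rightarrow> 'a \<Rightarrow> 'a \<Rightarrow> real" where
  "wedge \<alpha> \<beta> = (\<lambda>x y. \<alpha> x * \<beta> y - \<alpha> y * \<beta> x)"

subsection \<open>Pseudo-metrics and curvature\<close>

definition pseudo_metric :: "('a::real_vector \<Rightarrow> 'a \<Rightarrow> real) \<Rightarrow> bool" where
  "pseudo_metric g \<longleftrightarrow> bilinear g \<and> (\<forall>x y. g x y = g y x) \<and>
    (\<forall>x. (\<forall>y. g x y = 0) \<longrightarrow> x = 0)"

text \<open>The Levi-Civita connection on left-invariant vector fields: since \<open>g(y,z)\<close> is constant for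
  left-invariant \<open>y, z\<close>, metric compatibility reads \<open>g(\<nabla>\<^sub>x y, z) + g(y, \<nabla>\<^sub>x z) = 0\<close>.\<close>

definition is_levi_civita ::
    "('a::real_vector \<Rightarrow> 'a \<Rightarrow> 'a) \<Rightarrow> ('a \<Rightarrow> 'a \<Rightarrow> real) \<Rightarrow> ('a \<Rightarrow> 'a \<Rightarrow> 'a) \<Rightarrow> bool" where
  "is_levi_civita br g D \<longleftrightarrow> bilinear D \<and>
    (\<forall>x y. D x y - D y x = br x y) \<and>
    (\<forall>x y z. g (D x y) z + g y (D x z) = 0)"

definition levi_civita ::
    "('a::real_vector \<Rightarrow> 'a \<Rightarrow> 'a) \<Rightarrow> ('a \<Rightarrow> 'a \<Rightarrow> real) \<Rightarrow> 'a \<Rightarrow> 'a \<Rightarrow> 'a" where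
  "levi_civita br g = (THE D. is_levi_civita br g D)"

definition riemann ::
    "('a::real_vector \<Rightarrow> 'a \<Rightarrow> 'a) \<Rightarrow> ('a \<Rightarrow> 'a \<Rightarrow> real) \<Rightarrow> 'a \<Rightarrow> 'a \<Rightarrow> 'a \<Rightarrow> 'a" where
  "riemann br g x y z = (let D = levi_civita br g in D x (D y z) - D y (D x z) - D (br x y) z)"

text \<open>The trace of an endomorphism, computed in some basis (\<open>extend_basis {}\<close>) of the
  finite-dimensional space; \<open>trace_of_eq\<close> below shows that any basis gives the same value.\<close>

definition trace_of :: "('a::real_vector \<Rightarrow> 'a) \<Rightarrow> real" where
  "trace_of f = (\<Sum>b\<in>extend_basis {}. representation (extend_basis {}) (f b) b)"

definition ricci ::
    "('a::real_vector \<Rightarrow> 'a \<Rightarrow> 'a) \<Rightarrow> ('a \<Rightarrow> 'a \<Rightarrow> real) \<Rightarrow> 'a \<Rightarrow> 'a \<Rightarrow> real" where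
  "ricci br g x y = trace_of (\<lambda>z. riemann br g z x y)"

definition ricci_operator ::
    "('a::real_vector \<Rightarrow> 'a \<Rightarrow> 'a) \<Rightarrow> ('a \<Rightarrow> 'a \<Rightarrow> real) \<Rightarrow> 'a \<Rightarrow> 'a" where
  "ricci_operator br g x = (THE v. \<forall>y. g v y = ricci br g x y)"

definition scalar_curvature ::
    "('a::real_vector \<Rightarrow> 'a \<Rightarrow> 'a) \<Rightarrow> ('a \<Rightarrow> 'a \<Rightarrow> real) \<Rightarrow> real" where
  "scalar_curvature br g = trace_of (ricci_operator br g)"

definition einstein ::
    "('a::real_vector \<Rightarrow> 'a \<Rightarrow> 'a) \<Rightarrow> ('a \<Rightarrow> 'a \<Rightarrow> real) \<Rightarrow> bool" where
  "einstein br g \<longleftrightarrow> (\<exists>c. \<forall>x y. ricci br g x y = c * g x y)"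

subsection \<open>Well-definedness\<close>

lemma basis_extend_empty:
  shows "independent (extend_basis {} :: 'a::real_vector set)"
    and "span (extend_basis {} :: 'a set) = UNIV"
  using real_vector.independent_extend_basis[OF real_vector.independent_empty]
    real_vector.span_extend_basis[OF real_vector.independent_empty] by auto

lemma finite_extend_empty:
  assumes "dim (UNIV :: 'a::real_vector set) > 0"
  shows "finite (extend_basis {} :: 'a set)"
proof -
  have "dim (UNIV :: 'a set) = card (extend_basis {} :: 'a set)"
    using basis_extend_empty by (intro dim_eq_card) auto
  then show ?thesis using assms card_gt_0_iff by fastforce
qed

lemma trace_of_eq:
  fixes B :: "'a::real_vector set"
  assumes B: "independent B" "span B = UNIV" "finite B" and f: "linear f"
  shows "trace_of f = (\<Sum>b\<in>B. representation B (f b) b)"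
proof -
  define C where "C = (extend_basis {} :: 'a set)"
  have C: "independent C" "span C = UNIV" using basis_extend_empty by (auto simp: C_def)
  have "finite C"
    using independent_span_bound[OF B(3) C(1)] B(2) by auto
  have lin: "linear (\<lambda>v. representation B v b)" for b
    by (rule linearI) (auto simp: B representation_add representation_scale)
  have linC: "linear (\<lambda>v. representation C v b)" for b
    by (rule linearI) (auto simp: C representation_add representation_scale)
  have expB: "(\<Sum>b\<in>B. representation B v b *\<^sub>R b) = v" for v
    using B by (intro sum_representation_eq) auto
  have expC: "(\<Sum>b\<in>C. representation C v b *\<^sub>R b) = v" for v
    using C \<open>finite C\<close> by (intro sum_representation_eq) auto
  have "trace_of f = (\<Sum>c\<in>C. representation C (f c) c)"
    by (simp add: trace_of_def C_def)
  also have "\<dots> = (\<Sum>c\<in>C. \<Sum>b\<in>B. representation B c b * representation C (f b) c)"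
  proof (rule sum.cong[OF refl])
    fix c
    have "representation C (f c) c = representation C (f (\<Sum>b\<in>B. representation B c b *\<^sub>R b)) c"
      by (simp add: expB)
    also have "\<dots> = (\<Sum>b\<in>B. representation B c b * representation C (f b) c)"
      by (simp add: linear_sum[OF f] linear_scale[OF f] linear_sum[OF linC] linear_scale[OF linC])
    finally show "representation C (f c) c =
      (\<Sum>b\<in>B. representation B c b * representation C (f b) c)" .
  qed
  also have "\<dots> = (\<Sum>b\<in>B. \<Sum>c\<in>C. representation C (f b) c * representation B c b)"
    by (subst sum.swap) (simp add: mult.commute)
  also have "\<dots> = (\<Sum>b\<in>B. representation B (f b) b)"
  proof (rule sum.cong[OF refl])
    fix b
    have "representation B (f b) b = representation B (\<Sum>c\<in>C. representation C (f b) c *\<^sub>R c) b"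
      by (simp add: expC)
    also have "\<dots> = (\<Sum>c\<in>C. representation C (f b) c * representation B c b)"
      by (simp add: linear_sum[OF lin] linear_scale[OF lin])
    finally show "(\<Sum>c\<in>C. representation C (f b) c * representation B c b) =
      representation B (f b) b" by simp
  qed
  finally show ?thesis .
qed

lemma pseudo_metric_ext:
  assumes "pseudo_metric g" "\<And>y. g v y = g w y"
  shows "v = w"
proof -
  have "bilinear g" using assms(1) by (simp add: pseudo_metric_def)
  then have "g (v - w) y = 0" for y
    using assms(2) by (simp add: bilinear_lsub)
  then show ?thesis using assms(1) unfolding pseudo_metric_def by (metis right_minus_eq)
qed

lemma pseudo_metric_riesz:
  fixes g :: "'a::real_vector \<Rightarrow> 'a \<Rightarrow> real"
  assumes dim: "dim (UNIV :: 'a set) > 0" and g: "pseudo_metric g" and a: "linear \<alpha>"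
  shows "\<exists>!v. \<forall>y. g v y = \<alpha> y"
proof -
  define B where "B = (extend_basis {} :: 'a set)"
  have B: "independent B" "span B = UNIV" "finite B"
    using basis_extend_empty finite_extend_empty[OF dim] by (auto simp: B_def)
  interpret fd: finite_dimensional_vector_space "scaleR :: real \<Rightarrow> 'a \<Rightarrow> 'a" B
    by unfold_locales (use B in \<open>auto simp: dependent_raw_def span_raw_def\<close>)
  have bil: "bilinear g" using g by (simp add: pseudo_metric_def)
  define \<Psi> where "\<Psi> v = (\<Sum>b\<in>B. g v b *\<^sub>R b)" for v
  have lin\<Psi>: "linear \<Psi>"
    by (rule linearI) (auto simp: \<Psi>_def bilinear_ladd[OF bil] bilinear_lmul[OF bil]
        scaleR_add_left sum.distrib scaleR_sum_right)
  have onB: "\<forall>b\<in>B. u b = w b" if "(\<Sum>b\<in>B. u b *\<^sub>R b) = (\<Sum>b\<in>B. w b *\<^sub>R b)" for u w :: "'a \<Rightarrow> real"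
  proof -
    have "(\<Sum>b\<in>B. (u b - w b) *\<^sub>R b) = 0"
      using that by (simp add: scaleR_diff_left sum_subtractf)
    then have "\<forall>b\<in>B. u b - w b = 0"
      using independentD[OF B(1) B(3) order_refl, of "\<lambda>b. u b - w b"] by simp
    then show ?thesis by simp
  qed
  have agree: "\<beta> y = \<gamma> y" if "linear \<beta>" "linear \<gamma>" "\<forall>b\<in>B. \<beta> b = \<gamma> b" for \<beta> \<gamma> :: "'a \<Rightarrow> real" and y
    using linear_eq_on_span[OF that(1,2)] that(3) B(2) by blast
  have gl: "linear (g v)" for v using bil by (simp add: bilinear_def)
  have "inj \<Psi>"
  proof (rule injI)
    fix v w assume "\<Psi> v = \<Psi> w"
    then have "\<forall>b\<in>B. g v b = g w b" unfolding \<Psi>_def by (rule onB)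
    then have "g v y = g w y" for y by (rule agree[OF gl gl])
    then show "v = w" by (rule pseudo_metric_ext[OF g])
  qed
  then have "surj \<Psi>" using fd.linear_inj_imp_surj lin\<Psi> unfolding linear_def by blast
  then obtain v where "\<Psi> v = (\<Sum>b\<in>B. \<alpha> b *\<^sub>R b)" by (metis surjD)
  then have "\<forall>b\<in>B. g v b = \<alpha> b" unfolding \<Psi>_def by (rule onB)
  then have "\<forall>y. g v y = \<alpha> y" using agree[OF gl a] by blast
  then show ?thesis using pseudo_metric_ext[OF g] by metis
qed

lemma koszul:
  assumes g: "pseudo_metric g" and D: "is_levi_civita br g D"
  shows "2 * g (D x y) z = g (br x y) z - g (br y z) x + g (br z x) y"
proof -
  have bil: "bilinear g" and sym: "\<And>x y. g x y = g y x" using g by (auto simp: pseudo_metric_def)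
  have br: "br x y = D x y - D y x" for x y using D by (simp add: is_levi_civita_def)
  have m: "g (D x y) z = - g (D x z) y" for x y z
    using D sym unfolding is_levi_civita_def by (metis add_eq_0_iff)
  show ?thesis unfolding br bilinear_lsub[OF bil]
    using m[of x y z] m[of y x z] m[of z x y] by simp
qed

lemma ex1_levi_civita:
  fixes g :: "'a::real_vector \<Rightarrow> 'a \<Rightarrow> real"
  assumes dim: "dim (UNIV :: 'a set) > 0" and g: "pseudo_metric g" and L: "lie_algebra br"
  shows "\<exists>!D. is_levi_civita br g D"
proof (rule ex_ex1I)
  fix D D' assume "is_levi_civita br g D" "is_levi_civita br g D'"
  then have "g (D x y) z = g (D' x y) z" for x y z using koszul[OF g] by (metis mult_cancel_left zero_neq_numeral)
  then show "D = D'" using pseudo_metric_ext[OF g] by (intro ext) blast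
next
  have bil: "bilinear g" and sym: "\<And>x y. g x y = g y x" using g by (auto simp: pseudo_metric_def)
  have bb: "bilinear br" and alt: "\<And>x. br x x = 0" using L by (auto simp: lie_algebra_def)
  have skew: "br x y = - br y x" for x y
    using alt[of "x + y"] alt[of x] alt[of y]
    by (simp add: bilinear_ladd[OF bb] bilinear_radd[OF bb] eq_neg_iff_add_eq_0 add.commute)
  note s = bilinear_ladd[OF bil] bilinear_radd[OF bil] bilinear_lmul[OF bil] bilinear_rmul[OF bil]
    bilinear_ladd[OF bb] bilinear_radd[OF bb] bilinear_lmul[OF bb] bilinear_rmul[OF bb]
    bilinear_lneg[OF bil] bilinear_lsub[OF bil]
  define K where "K x y z = (g (br x y) z - g (br y z) x + g (br z x) y) / 2" for x y z
  have "linear (K x y)" for x y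
    by (rule linearI) (auto simp: K_def s algebra_simps add_divide_distrib diff_divide_distrib)
  then have "\<forall>x y. \<exists>v. \<forall>z. g v z = K x y z" using pseudo_metric_riesz[OF dim g] by blast
  then obtain D where D: "\<And>x y z. g (D x y) z = K x y z" by metis
  note e = pseudo_metric_ext[OF g]
  have "linear (\<lambda>y. D x y)" for x
    by (rule linearI; rule e; simp add: D s) (auto simp: K_def s field_simps)
  moreover have "linear (\<lambda>x. D x y)" for y
    by (rule linearI; rule e; simp add: D s) (auto simp: K_def s field_simps)
  moreover have "D x y - D y x = br x y" for x y
  proof (rule e)
    fix z
    show "g (D x y - D y x) z = g (br x y) z"
      using skew[of y x] skew[of z x] skew[of z y] by (simp add: D s K_def field_simps)
  qed
  moreover have "g (D x y) z + g y (D x z) = 0" for x y z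
    using skew[of y x] skew[of z x] skew[of z y] by (simp add: D sym[of y] s K_def field_simps)
  ultimately show "\<exists>D. is_levi_civita br g D"
    unfolding is_levi_civita_def bilinear_def by blast
qed

lemma trace_of_scale:
  "trace_of (\<lambda>x::'a::real_vector. c *\<^sub>R x) = c * dim (UNIV :: 'a set)"
proof -
  have "dim (UNIV :: 'a set) = card (extend_basis {} :: 'a set)"
    using basis_extend_empty by (intro dim_eq_card) auto
  then show ?thesis
    by (simp add: trace_of_def basis_extend_empty representation_scale representation_basis)
qed

lemma scalar_curvature_einstein:
  fixes g :: "'a::real_vector \<Rightarrow> 'a \<Rightarrow> real"
  assumes g: "pseudo_metric g" and c: "\<And>x y. ricci br g x y = c * g x y"
  shows "scalar_curvature br g = c * dim (UNIV :: 'a set)"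
proof -
  have "bilinear g" using g by (simp add: pseudo_metric_def)
  then have "ricci_operator br g x = c *\<^sub>R x" for x
    unfolding ricci_operator_def c
    using pseudo_metric_ext[OF g] by (intro the_equality) (auto simp: bilinear_lmul)
  then have "ricci_operator br g = (\<lambda>x. c *\<^sub>R x)" by blast
  then show ?thesis unfolding scalar_curvature_def by (simp add: trace_of_scale)
qed

text \<open>The structure equations satisfy the Jacobi identity and define a nilpotent Lie algebra.\<close>

lemma structure_equations_consistent:
  "\<exists>(br :: (real \<times> real \<times> real \<times> real \<times> real \<times> real \<times> real) \<Rightarrow> _ \<Rightarrow> _) (e :: nat \<Rightarrow> (real \<times> real \<times> real \<times> real \<times> real \<times> real \<times> real) \<Rightarrow> real).
    dim (UNIV :: (real \<times> real \<times> real \<times> real \<times> real \<times> real \<times> real) set) = 7 \<and>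
    nilpotent_lie_algebra br \<and> dual_space_basis 7 e \<and>
    ce_diff br (e 1) = (\<lambda>x y. 0) \<and> ce_diff br (e 2) = (\<lambda>x y. 0) \<and>
    ce_diff br (e 3) = wedge (e 1) (e 2) \<and>
    ce_diff br (e 4) = wedge (e 1) (e 3) \<and>
    ce_diff br (e 5) = wedge (e 1) (e 4) \<and>
    ce_diff br (e 6) = (\<lambda>x y. wedge (e 1) (e 5) x y + wedge (e 2) (e 3) x y) \<and>
    ce_diff br (e 7) =
      (\<lambda>x y. wedge (e 1) (e 6) x y + wedge (e 2) (e 3) x y + wedge (e 2) (e 4) x y)"
proof -
  define br :: "(real \<times> real \<times> real \<times> real \<times> real \<times> real \<times> real) \<Rightarrow> (real \<times> real \<times> real \<times> real \<times> real \<times> real \<times> real) \<Rightarrow> (real \<times> real \<times> real \<times> real \<times> real \<times> real \<times> real)" where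
    "br = (\<lambda>(x1, x2, x3, x4, x5, x6, x7) (y1, y2, y3, y4, y5, y6, y7).
      (0,
       0,
       (x2 * y1 - x1 * y2),
       (x3 * y1 - x1 * y3),
       (x4 * y1 - x1 * y4),
       (x5 * y1 - x1 * y5) + (x3 * y2 - x2 * y3),
       (x6 * y1 - x1 * y6) + (x3 * y2 - x2 * y3) + (x4 * y2 - x2 * y4)))"
  define e :: "nat \<Rightarrow> (real \<times> real \<times> real \<times> real \<times> real \<times> real \<times> real) \<Rightarrow> real" where
    "e = (\<lambda>i (x1, x2, x3, x4, x5, x6, x7).
      if i = 1 then x1 else if i = 2 then x2 else if i = 3 then x3 else if i = 4 then x4 else if i = 5 then x5 else if i = 6 then x6 else x7)"
  have e_simps: "e (Suc 0) (x1, x2, x3, x4, x5, x6, x7) = x1" "e 2 (x1, x2, x3, x4, x5, x6, x7) = x2" "e 3 (x1, x2, x3, x4, x5, x6, x7) = x3" "e 4 (x1, x2, x3, x4, x5, x6, x7) = x4" "e 5 (x1, x2, x3, x4, x5, x6, x7) = x5" "e 6 (x1, x2, x3, x4, x5, x6, x7) = x6" "e 7 (x1, x2, x3, x4, x5, x6, x7) = x7"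
    for x1 x2 x3 x4 x5 x6 x7 by (simp_all add: e_def)
  have s7: "sum f {Suc 0..7} = f (Suc 0) + f 2 + f 3 + f 4 + f 5 + f 6 + f 7" for f :: "nat \<Rightarrow> real"
    by (simp add: numeral_eq_Suc)
  have b7: "(\<forall>i\<in>{Suc 0..7}. P i) \<longleftrightarrow> P (Suc 0) \<and> P 2 \<and> P 3 \<and> P 4 \<and> P 5 \<and> P 6 \<and> P 7" for P
  proof -
    have "{Suc 0..7} = {Suc 0, 2, 3, 4, 5, 6, 7}" by auto
    then show ?thesis by simp
  qed
  have lie: "lie_algebra br"
    unfolding lie_algebra_def bilinear_def linear_iff
    by (auto simp: br_def algebra_simps prod_eq_iff)
  define Z :: "nat \<Rightarrow> (real \<times> real \<times> real \<times> real \<times> real \<times> real \<times> real) set" where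
    "Z k = {x. \<forall>i\<in>{Suc 0..7}. i \<le> k \<longrightarrow> e i x = 0}" for k
  have sub: "subspace (Z k)" for k
    unfolding subspace_def Z_def b7 by (auto simp: e_simps zero_prod_def)
  have L: "lower_central br (Suc k) \<subseteq> Z (k + 2)" for k
  proof (induction k)
    case 0
    show ?case unfolding lower_central.simps
      by (rule span_minimal[OF _ sub]) (auto simp: Z_def b7 br_def e_simps)
  next
    case (Suc k)
    have "br x y \<in> Z (Suc k + 2)" if "y \<in> Z (k + 2)" for x y
      using that unfolding Z_def b7 by (cases x, cases y) (auto simp: br_def e_simps)
    then show ?case using Suc.IH
      unfolding lower_central.simps(2)[of br "Suc k"]
      by (intro span_minimal[OF _ sub]) blast
  qed
  have "Z 7 \<subseteq> {0}" unfolding Z_def b7 by (auto simp: e_simps prod_eq_iff)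
  moreover have "lower_central br 6 \<subseteq> Z 7" using L[of 5] by simp
  moreover have "0 \<in> lower_central br 6"
    using lower_central.simps(2)[of br 5] by (simp add: span_zero)
  ultimately have "lower_central br 6 = {0}" by blast
  then have nil: "nilpotent_lie_algebra br" using lie unfolding nilpotent_lie_algebra_def by blast
  have "\<exists>c. \<alpha> = (\<lambda>x. \<Sum>i=1..7. c i * e i x)" if "linear \<alpha>" for \<alpha> :: "(real \<times> real \<times> real \<times> real \<times> real \<times> real \<times> real) \<Rightarrow> real"
  proof -
    define c where "c = (\<lambda>i::nat. if i = 1 then \<alpha> (1, 0, 0, 0, 0, 0, 0) else
      if i = 2 then \<alpha> (0, 1, 0, 0, 0, 0, 0) else
      if i = 3 then \<alpha> (0, 0, 1, 0, 0, 0, 0) else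
      if i = 4 then \<alpha> (0, 0, 0, 1, 0, 0, 0) else
      if i = 5 then \<alpha> (0, 0, 0, 0, 1, 0, 0) else
      if i = 6 then \<alpha> (0, 0, 0, 0, 0, 1, 0) else \<alpha> (0, 0, 0, 0, 0, 0, 1))"
    have "\<alpha> (x1, x2, x3, x4, x5, x6, x7) = (\<Sum>i=1..7. c i * e i (x1, x2, x3, x4, x5, x6, x7))" for x1 x2 x3 x4 x5 x6 x7
    proof -
      have "(x1, x2, x3, x4, x5, x6, x7) = x1 *\<^sub>R (1, 0, 0, 0, 0, 0, 0) + x2 *\<^sub>R (0, 1, 0, 0, 0, 0, 0) + x3 *\<^sub>R (0, 0, 1, 0, 0, 0, 0) + x4 *\<^sub>R (0, 0, 0, 1, 0, 0, 0) + x5 *\<^sub>R (0, 0, 0, 0, 1, 0, 0) + x6 *\<^sub>R (0, 0, 0, 0, 0, 1, 0) + x7 *\<^sub>R (0, 0, 0, 0, 0, 0, 1)"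
        by simp
      then have "\<alpha> (x1, x2, x3, x4, x5, x6, x7) = x1 * \<alpha> (1, 0, 0, 0, 0, 0, 0) + x2 * \<alpha> (0, 1, 0, 0, 0, 0, 0) + x3 * \<alpha> (0, 0, 1, 0, 0, 0, 0) + x4 * \<alpha> (0, 0, 0, 1, 0, 0, 0) + x5 * \<alpha> (0, 0, 0, 0, 1, 0, 0) + x6 * \<alpha> (0, 0, 0, 0, 0, 1, 0) + x7 * \<alpha> (0, 0, 0, 0, 0, 0, 1)"
        using that by (simp only: linear_add linear_scale real_scaleR_def)
      then show ?thesis by (simp add: s7 e_simps c_def mult.commute)
    qed
    then show ?thesis by (intro exI[of _ c]) (auto simp: fun_eq_iff)
  qed
  moreover have "\<forall>i\<in>{1..7}. c i = 0" if "(\<lambda>x. \<Sum>i=1..7. c i * e i x) = (\<lambda>x. 0)" for c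
  proof -
    have "(\<Sum>i=1..7. c i * e i x) = 0" for x using that by meson
    from this[of "(1, 0, 0, 0, 0, 0, 0)"] this[of "(0, 1, 0, 0, 0, 0, 0)"] this[of "(0, 0, 1, 0, 0, 0, 0)"] this[of "(0, 0, 0, 1, 0, 0, 0)"] this[of "(0, 0, 0, 0, 1, 0, 0)"] this[of "(0, 0, 0, 0, 0, 1, 0)"] this[of "(0, 0, 0, 0, 0, 0, 1)"]
    show ?thesis by (simp add: s7 b7 e_simps)
  qed
  moreover have "\<forall>i\<in>{1..7}. linear (e i)"
    by (simp add: b7 linear_iff e_simps)
  ultimately have dual: "dual_space_basis 7 e" unfolding dual_space_basis_def by blast
  have "dim (UNIV :: (real \<times> real \<times> real \<times> real \<times> real \<times> real \<times> real) set) = 7" by simp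
  with nil dual show ?thesis
    by (intro exI[of _ br] exI[of _ e]) (auto simp: ce_diff_def wedge_def fun_eq_iff br_def e_simps)
qed

end

theory Submission
  imports Defs
begin

text \<open>
  The metric is diagonal, \<open>g = \<Sum>k w\<^sub>k (F\<^sup>k)\<^sup>2\<close>, in a coframe \<open>F\<close> obtained from \<open>e\<close> by a
  unipotent change of basis that adds to \<open>e\<^sup>5, e\<^sup>6, e\<^sup>7\<close> multiples of earlier forms
  (\<open>sheared_coframe\<close>). In this coframe the structure equations become
  \<open>dF\<^sup>3 = F\<^sup>1\<^sup>2\<close>, \<open>dF\<^sup>4 = F\<^sup>1\<^sup>3\<close>, \<open>dF\<^sup>5 = F\<^sup>1\<^sup>4 + p F\<^sup>1\<^sup>3\<close>, \<open>dF\<^sup>6 = F\<^sup>1\<^sup>5 + q F\<^sup>1\<^sup>4 + F\<^sup>2\<^sup>3\<close>,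
  \<open>dF\<^sup>7 = F\<^sup>1\<^sup>6 + r F\<^sup>1\<^sup>5 + t F\<^sup>2\<^sup>3 + F\<^sup>2\<^sup>4\<close>, with \<open>p, q, r\<close> free and \<open>t = 1 + p + q + r\<close>.
  The constant 1 in \<open>t\<close> is the term \<open>e\<^sup>2\<^sup>3\<close> of \<open>de\<^sup>7\<close>. It is what makes a nonzero Einstein constant
  possible: without it the algebra is graded by positive weights, and a derivation of nonzero
  trace obstructs Einstein metrics that are not Ricci-flat.

  For a unimodular Lie algebra the Ricci tensor is \<open>Ric(x,y) = - tr(A\<^sub>x A\<^sub>y)\<close> with
  \<open>A\<^sub>x z = \<nabla>\<^sub>z x\<close> (\<open>ricci_eq_trace\<close>). In an orthogonal basis the Koszul formula splits the matrix of
  \<open>A\<^sub>x\<close> into a symmetric and a skew part, and the trace becomes a quadratic expression in the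
  structure constants (\<open>ricci_orthogonal_basis\<close>). For the coframe above only the seven squares
  and four mixed products \<open>F\<^sup>3F\<^sup>4\<close>, \<open>F\<^sup>4F\<^sup>5\<close>, \<open>F\<^sup>5F\<^sup>6\<close>, \<open>F\<^sup>6F\<^sup>7\<close> survive (\<open>ricci_adapted\<close>).
  So \<open>2 Ric = g\<close> is a system of eleven equations in \<open>w, p, q, r, t\<close> (\<open>einstein_system\<close>), and it has a
  real solution with coordinates in \<open>\<rat>(\<surd>399)\<close> (\<open>einstein_system_solvable\<close>). The metric so obtained
  has \<open>w\<^sub>4, w\<^sub>6 < 0\<close> and the other weights positive, and its scalar curvature is \<open>7/2\<close>.
\<close>

section \<open>Dual bases and traces\<close>

locale dual_bases =
  fixes I :: "'i set" and e :: "'i \<Rightarrow> 'a::real_vector \<Rightarrow> real" and v :: "'i \<Rightarrow> 'a"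
  assumes finite_index: "finite I"
    and linear_dual: "i \<in> I \<Longrightarrow> linear (e i)"
    and pairing: "i \<in> I \<Longrightarrow> j \<in> I \<Longrightarrow> e i (v j) = (if i = j then 1 else 0)"
    and expansion: "(\<Sum>i\<in>I. e i x *\<^sub>R v i) = x"
begin

lemma trace_of_eq_sum_dual:
  assumes f: "linear f"
  shows "trace_of f = (\<Sum>i\<in>I. e i (f (v i)))"
proof -
  define B where "B = v ` I"
  have inj: "inj_on v I"
    by (rule inj_onI) (metis pairing zero_neq_one)
  have coefficient: "e i (\<Sum>b\<in>B. u b *\<^sub>R b) = u (v i)" if "i \<in> I" for i u
  proof -
    have "e i (\<Sum>b\<in>B. u b *\<^sub>R b) = (\<Sum>j\<in>I. u (v j) * e i (v j))"
      unfolding B_def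
      by (simp add: sum.reindex[OF inj] linear_sum[OF linear_dual[OF that]]
          linear_scale[OF linear_dual[OF that]])
    also have "\<dots> = (\<Sum>j\<in>I. if i = j then u (v j) else 0)"
      by (rule sum.cong) (simp_all add: pairing[OF that])
    finally show ?thesis using that finite_index by simp
  qed
  have fin: "finite B" by (simp add: B_def finite_index)
  have indep: "independent B"
    unfolding dependent_finite[OF fin]
  proof
    assume "\<exists>u. (\<exists>b\<in>B. u b \<noteq> 0) \<and> (\<Sum>b\<in>B. u b *\<^sub>R b) = 0"
    then obtain u i where "i \<in> I" "u (v i) \<noteq> 0" "(\<Sum>b\<in>B. u b *\<^sub>R b) = 0"
      unfolding B_def by auto
    then show False using coefficient[of i u] linear_0[OF linear_dual] by simp
  qed
  have "x \<in> span B" for x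
    using span_sum[of "I" "\<lambda>i. e i x *\<^sub>R v i" B]
    by (simp add: expansion B_def span_base span_scale)
  then have spans: "span B = UNIV" by blast
  have "trace_of f = (\<Sum>i\<in>I. representation B (f (v i)) (v i))"
    by (simp add: trace_of_eq[OF indep spans fin f] B_def sum.reindex[OF inj])
  also have "representation B x (v i) = e i x" if "i \<in> I" for x i
    using coefficient[OF that, of "representation B x"]
    by (simp add: sum_representation_eq[OF indep _ fin] spans)
  then have "(\<Sum>i\<in>I. representation B (f (v i)) (v i)) = (\<Sum>i\<in>I. e i (f (v i)))"
    by (intro sum.cong) auto
  finally show ?thesis .
qed

text \<open>
  Besides the matrix form of the trace of a product, this double sum gives the cyclicity of the
  trace by exchanging \<open>i\<close> and \<open>j\<close>.
\<close>

lemma trace_of_compose: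
  fixes f h :: "'a \<Rightarrow> 'a"
  assumes f: "linear f" and h: "linear h"
  shows "trace_of (\<lambda>z. f (h z)) = (\<Sum>i\<in>I. \<Sum>j\<in>I. e j (h (v i)) * e i (f (v j)))"
proof -
  have "e i (f y) = (\<Sum>j\<in>I. e j y * e i (f (v j)))" if i: "i \<in> I" for i y
  proof -
    have "e i (f y) = e i (f (\<Sum>j\<in>I. e j y *\<^sub>R v j))" by (simp add: expansion)
    then show ?thesis
      by (simp add: linear_sum[OF f] linear_scale[OF f] linear_sum[OF linear_dual[OF i]]
          linear_scale[OF linear_dual[OF i]])
  qed
  then show ?thesis
    using linear_compose[OF h f] by (simp add: trace_of_eq_sum_dual o_def)
qed

lemma trace_of_commute:
  fixes f h :: "'a \<Rightarrow> 'a"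
  assumes "linear f" "linear h"
  shows "trace_of (\<lambda>z. f (h z)) = trace_of (\<lambda>z. h (f z))"
  unfolding trace_of_compose[OF assms] trace_of_compose[OF assms(2,1)]
  by (subst sum.swap) (simp add: mult.commute)

lemma trace_of_add:
  fixes f h :: "'a \<Rightarrow> 'a"
  assumes "linear f" "linear h"
  shows "trace_of (\<lambda>z. f z + h z) = trace_of f + trace_of h"
  using linear_compose_add[OF assms] assms
  by (simp add: trace_of_eq_sum_dual linear_add[OF linear_dual] sum.distrib)

lemma trace_of_diff:
  fixes f h :: "'a \<Rightarrow> 'a"
  assumes "linear f" "linear h"
  shows "trace_of (\<lambda>z. f z - h z) = trace_of f - trace_of h"
  using linear_compose_sub[OF assms] assms
  by (simp add: trace_of_eq_sum_dual linear_diff[OF linear_dual] sum_subtractf)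

end

text \<open>
  The coefficients of the coordinate functionals of any basis, expressed in \<open>e\<close>, are the
  coordinates of the vectors dual to \<open>e\<close>. The pairing with \<open>e\<close> then follows by comparing
  coefficients in \<open>e\<^sub>j = \<Sum>i e\<^sub>j(v\<^sub>i) e\<^sub>i\<close>.
\<close>

lemma dual_basis_exists:
  fixes e :: "nat \<Rightarrow> 'a::real_vector \<Rightarrow> real"
  assumes dim: "dim (UNIV :: 'a set) > 0" and e: "dual_space_basis n e"
  obtains v where "dual_bases {1..n} e v"
proof -
  define B where "B = (extend_basis {} :: 'a set)"
  have B: "independent B" "span B = UNIV" "finite B"
    using basis_extend_empty finite_extend_empty[OF dim] by (auto simp: B_def)
  have lin: "linear (e i)" if "i \<in> {1..n}" for i
    using e that by (simp add: dual_space_basis_def)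
  have independent: "\<forall>i\<in>{1..n}. c i = 0" if "(\<lambda>x. \<Sum>i=1..n. c i * e i x) = (\<lambda>x. 0)" for c
    using e that unfolding dual_space_basis_def by blast
  have "linear (\<lambda>x. representation B x b)" for b
    by (rule linearI) (auto simp: B representation_add representation_scale)
  then have "\<forall>b. \<exists>c. (\<lambda>x. representation B x b) = (\<lambda>x. \<Sum>i=1..n. c i * e i x)"
    using e unfolding dual_space_basis_def by blast
  then obtain c where c: "\<And>b x. representation B x b = (\<Sum>i=1..n. c b i * e i x)"
    by (metis (no_types))
  define v where "v i = (\<Sum>b\<in>B. c b i *\<^sub>R b)" for i
  have expand: "(\<Sum>i=1..n. e i x *\<^sub>R v i) = x" for x
  proof -
    have "(\<Sum>i=1..n. e i x *\<^sub>R v i) = (\<Sum>b\<in>B. representation B x b *\<^sub>R b)"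
      unfolding v_def c
      by (simp add: scaleR_sum_right scaleR_sum_left mult.commute) (rule sum.swap)
    then show ?thesis using B by (simp add: sum_representation_eq)
  qed
  have pairing: "e j (v i) = (if j = i then 1 else 0)" if i: "i \<in> {1..n}" and j: "j \<in> {1..n}" for i j
  proof -
    have "(\<Sum>i=1..n. (e j (v i) - (if j = i then 1 else 0)) * e i x) = 0" for x
    proof -
      have "(\<Sum>i=1..n. (e j (v i) - (if j = i then 1 else 0)) * e i x) =
          e j (\<Sum>i=1..n. e i x *\<^sub>R v i) - (\<Sum>i=1..n. if j = i then e i x else 0)"
        unfolding linear_sum[OF lin[OF j]] linear_scale[OF lin[OF j]] sum_subtractf[symmetric]
        by (rule sum.cong) (auto simp: left_diff_distrib)
      then show ?thesis using j by (simp add: expand[unfolded One_nat_def])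
    qed
    then have "\<forall>i\<in>{1..n}. e j (v i) - (if j = i then 1 else 0) = 0"
      by (intro independent[of "\<lambda>i. e j (v i) - (if j = i then 1 else 0)"] ext)
    then have "e j (v i) - (if j = i then 1 else 0) = 0" using i by (rule bspec)
    then show ?thesis by simp
  qed
  have "dual_bases {1..n} e v"
    by (rule dual_bases.intro) (rule finite_atLeastAtMost lin pairing expand; assumption)+
  then show ?thesis by (rule that)
qed

section \<open>The Ricci tensor of a unimodular Lie algebra\<close>

definition diagonal_metric ::
    "'i set \<Rightarrow> ('i \<Rightarrow> 'a::real_vector \<Rightarrow> real) \<Rightarrow> ('i \<Rightarrow> real) \<Rightarrow> 'a \<Rightarrow> 'a \<Rightarrow> real" where
  "diagonal_metric I e w x y = (\<Sum>i\<in>I. w i * e i x * e i y)"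

lemma (in dual_bases) diagonal_metric_basis:
  assumes "i \<in> I"
  shows "diagonal_metric I e w x (v i) = w i * e i x"
proof -
  have "diagonal_metric I e w x (v i) = (\<Sum>j\<in>I. if i = j then w j * e j x else 0)"
    unfolding diagonal_metric_def using assms by (intro sum.cong) (auto simp: pairing)
  then show ?thesis using assms finite_index by simp
qed

lemma (in dual_bases) pseudo_metric_diagonal:
  assumes w: "\<And>i. i \<in> I \<Longrightarrow> w i \<noteq> 0"
  shows "pseudo_metric (diagonal_metric I e w)"
  unfolding pseudo_metric_def
proof (intro conjI allI impI)
  have "linear (\<lambda>y. w i * e i x * e i y)" "linear (\<lambda>x. w i * e i x * e i y)" if "i \<in> I" for i x y
    using linear_dual[OF that] by (auto simp: linear_iff algebra_simps)
  then show "bilinear (diagonal_metric I e w)"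
    unfolding bilinear_def diagonal_metric_def by (auto intro!: linear_compose_sum)
  show "diagonal_metric I e w x y = diagonal_metric I e w y x" for x y
    by (simp add: diagonal_metric_def mult.commute mult.left_commute)
  show "x = 0" if "\<forall>y. diagonal_metric I e w x y = 0" for x
  proof -
    have "e i x = 0" if "i \<in> I" for i
      using diagonal_metric_basis[OF that, of w x] w[OF that]
        \<open>\<forall>y. diagonal_metric I e w x y = 0\<close> by simp
    then show "x = 0" using expansion[of x] by simp
  qed
qed

locale orthogonal_lie_algebra = dual_bases I e v
  for I :: "'i set" and e :: "'i \<Rightarrow> 'a::real_vector \<Rightarrow> real" and v :: "'i \<Rightarrow> 'a" +
  fixes br :: "'a \<Rightarrow> 'a \<Rightarrow> 'a" and w :: "'i \<Rightarrow> real"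
  assumes dim_pos: "dim (UNIV :: 'a set) > 0"
    and lie: "lie_algebra br"
    and weight_nonzero: "i \<in> I \<Longrightarrow> w i \<noteq> 0"
    and unimodular: "trace_of (br x) = 0"
begin

abbreviation g :: "'a \<Rightarrow> 'a \<Rightarrow> real" where "g \<equiv> diagonal_metric I e w"

lemma bilinear_bracket: "bilinear br" and bracket_self: "br x x = 0"
  using lie by (auto simp: lie_algebra_def)

lemma metric: "pseudo_metric g"
  by (rule pseudo_metric_diagonal[OF weight_nonzero])

lemma bilinear_metric: "bilinear g" and metric_sym: "g x y = g y x"
  using metric by (auto simp: pseudo_metric_def)

lemma bracket_skew: "br x y = - br y x"
  using bracket_self[of "x + y"] bracket_self[of x] bracket_self[of y]
  by (simp add: bilinear_ladd[OF bilinear_bracket] bilinear_radd[OF bilinear_bracket]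
      eq_neg_iff_add_eq_0 add.commute)

lemma dual_via_metric:
  assumes "i \<in> I"
  shows "e i x = g x (v i) / w i"
  using weight_nonzero[OF assms] by (simp add: diagonal_metric_basis[OF assms])

lemma levi_civita_connection: "is_levi_civita br g (levi_civita br g)"
  unfolding levi_civita_def using ex1_levi_civita[OF dim_pos metric lie] by (rule theI')

abbreviation D :: "'a \<Rightarrow> 'a \<Rightarrow> 'a" where "D \<equiv> levi_civita br g"

lemma bilinear_D: "bilinear D" and torsion_free: "D x y = D y x + br x y"
  and metric_parallel: "g (D x y) z = - g y (D x z)"
proof -
  show "bilinear D"
    using levi_civita_connection by (simp add: is_levi_civita_def)
  have "D x y - D y x = br x y"
    using levi_civita_connection by (simp add: is_levi_civita_def)
  then show "D x y = D y x + br x y" by (simp add: diff_eq_eq add.commute)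
  have "g (D x y) z + g y (D x z) = 0"
    using levi_civita_connection by (simp add: is_levi_civita_def)
  then show "g (D x y) z = - g y (D x z)" by simp
qed

lemma linear_maps: "linear (D x)" "linear (\<lambda>z. D z x)" "linear (br x)"
  using bilinear_D bilinear_bracket by (auto simp: bilinear_def)

text \<open>
  The endomorphisms \<open>\<nabla> u\<close> and \<open>\<nabla>\<^sub>u\<close> differ by \<open>ad u\<close>, which is traceless by unimodularity, and
  \<open>\<nabla>\<^sub>u\<close> is traceless because it is skew with respect to the metric.
\<close>

lemma divergence_zero: "trace_of (\<lambda>z. D z u) = 0"
proof -
  have "e i (D u (v i)) = 0" if "i \<in> I" for i
    using metric_parallel[of u "v i" "v i"] metric_sym[of "v i"] that
    by (simp add: dual_via_metric)
  then have "trace_of (D u) = 0"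
    by (simp add: trace_of_eq_sum_dual[OF linear_maps(1)])
  moreover have "(\<lambda>z. D z u) = (\<lambda>z. D u z - br u z)"
    using torsion_free[of _ u] bracket_skew[of u] by (simp add: fun_eq_iff)
  ultimately show ?thesis
    using trace_of_diff[OF linear_maps(1,3)] unimodular by simp
qed

text \<open>
  Write \<open>A\<^sub>x z = \<nabla>\<^sub>z x\<close>, so that \<open>\<nabla>\<^sub>x = A\<^sub>x + ad x\<close>. Then \<open>z \<mapsto> R(z,x)y\<close> is
  \<open>\<nabla>(\<nabla>\<^sub>x y) - A\<^sub>x A\<^sub>y - ad x A\<^sub>y + A\<^sub>y ad x\<close>: the first term is a divergence, and the last two
  cancel under the trace.
\<close>

lemma ricci_eq_trace: "ricci br g x y = - trace_of (\<lambda>z. D (D z y) x)"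
proof -
  have riem: "riemann br g z x y = D z (D x y) - D (D z y) x - br x (D z y) + D (br x z) y" for z
    using torsion_free[of x "D z y"] bracket_skew[of z x]
    by (simp add: riemann_def Let_def bilinear_lneg[OF bilinear_D])
  note l = linear_maps linear_compose[OF linear_maps(2) linear_maps(2), unfolded o_def]
    linear_compose[OF linear_maps(2) linear_maps(3), unfolded o_def]
    linear_compose[OF linear_maps(3) linear_maps(2), unfolded o_def]
  have "ricci br g x y = trace_of (\<lambda>z. D z (D x y)) - trace_of (\<lambda>z. D (D z y) x)
      - trace_of (\<lambda>z. br x (D z y)) + trace_of (\<lambda>z. D (br x z) y)"
    unfolding ricci_def riem
    by (simp add: trace_of_add trace_of_diff l linear_compose_sub)
  then show ?thesis
    using divergence_zero trace_of_commute[OF linear_maps(3,2)] by simp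
qed

text \<open>
  By the Koszul formula, \<open>-2 g(\<nabla>\<^bsub>v\<^sub>i\<^esub> x, v\<^sub>j)\<close> is the sum of the part
  \<open>S x i j = g([x,v\<^sub>i],v\<^sub>j) + g([x,v\<^sub>j],v\<^sub>i)\<close>, symmetric in \<open>i, j\<close>, and the skew part
  \<open>N x i j = g([v\<^sub>i,v\<^sub>j],x)\<close>. In the trace of a product the two parts do not interact, and the
  skew one enters with the opposite sign.
\<close>

theorem ricci_orthogonal_basis:
  "ricci br g x y = (\<Sum>i\<in>I. \<Sum>j\<in>I.
     (g (br (v i) (v j)) x * g (br (v i) (v j)) y
      - (g (br x (v i)) (v j) + g (br x (v j)) (v i)) *
        (g (br y (v i)) (v j) + g (br y (v j)) (v i))) / (w i * w j)) / 4"
proof -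
  define N where "N x i j = g (br (v i) (v j)) x" for x i j
  define S where "S x i j = g (br x (v i)) (v j) + g (br x (v j)) (v i)" for x i j
  have N: "N x j i = - N x i j" for x i j
    using bracket_skew[of "v i" "v j"] by (simp add: N_def bilinear_lneg[OF bilinear_metric])
  have S: "S x j i = S x i j" for x i j
    by (simp add: S_def)
  have D_coeff: "g (D (v i) x) (v j) = (- S x i j - N x i j) / 2" for x i j
    using koszul[OF metric levi_civita_connection, of "v i" x "v j"] bracket_skew[of "v i" x]
      bracket_skew[of "v j" "v i"]
    by (simp add: S_def N_def bilinear_lneg[OF bilinear_metric])
  have "trace_of (\<lambda>z. D (D z y) x) =
      (\<Sum>i\<in>I. \<Sum>j\<in>I. g (D (v i) y) (v j) * g (D (v j) x) (v i) / (w i * w j))"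
    unfolding trace_of_compose[OF linear_maps(2) linear_maps(2)]
    by (intro sum.cong) (simp_all add: dual_via_metric)
  also have "\<dots> = (\<Sum>i\<in>I. \<Sum>j\<in>I.
      (S x i j * S y i j - N x i j * N y i j) / (w i * w j) / 4
      + (N y i j * S x i j - S y i j * N x i j) / (w i * w j) / 4)"
  proof (intro sum.cong refl)
    fix i j
    have "g (D (v i) y) (v j) * g (D (v j) x) (v i) =
        (S x i j * S y i j - N x i j * N y i j) / 4 + (N y i j * S x i j - S y i j * N x i j) / 4"
      unfolding D_coeff N[of x j i] S[of x j i] by (simp add: field_simps)
    then show "g (D (v i) y) (v j) * g (D (v j) x) (v i) / (w i * w j) =
        (S x i j * S y i j - N x i j * N y i j) / (w i * w j) / 4
        + (N y i j * S x i j - S y i j * N x i j) / (w i * w j) / 4"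
      by (simp add: add_divide_distrib)
  qed
  also have "\<dots> = (\<Sum>i\<in>I. \<Sum>j\<in>I. (S x i j * S y i j - N x i j * N y i j) / (w i * w j) / 4)
      + (\<Sum>i\<in>I. \<Sum>j\<in>I. (N y i j * S x i j - S y i j * N x i j) / (w i * w j) / 4)"
    by (simp add: sum.distrib)
  also have "(\<Sum>i\<in>I. \<Sum>j\<in>I. (N y i j * S x i j - S y i j * N x i j) / (w i * w j) / 4) = 0"
    (is "?c = 0")
  proof -
    have "?c = (\<Sum>i\<in>I. \<Sum>j\<in>I. (N y j i * S x j i - S y j i * N x j i) / (w j * w i) / 4)"
      by (rule sum.swap)
    also have "\<dots> = (\<Sum>i\<in>I. \<Sum>j\<in>I. - ((N y i j * S x i j - S y i j * N x i j) / (w i * w j) / 4))"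
    proof (intro sum.cong refl)
      fix i j
      have "N y j i * S x j i - S y j i * N x j i = - (N y i j * S x i j - S y i j * N x i j)"
        unfolding N[of _ j i] S[of _ j i] by simp
      then show "(N y j i * S x j i - S y j i * N x j i) / (w j * w i) / 4 =
          - ((N y i j * S x i j - S y i j * N x i j) / (w i * w j) / 4)"
        by (simp only: mult.commute[of "w j"] minus_divide_left)
    qed
    also have "\<dots> = - ?c" by (simp add: sum_negf)
    finally show ?thesis by simp
  qed
  finally show ?thesis
    unfolding ricci_eq_trace N_def[symmetric] S_def[symmetric]
    by (simp add: sum_divide_distrib sum_negf[symmetric] minus_divide_left)
qed

end

section \<open>The metric on the seven-dimensional algebra\<close>

lemma index_set_7: "{1..7::nat} = {1, 2, 3, 4, 5, 6, 7}"
  by auto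

lemma sum_7:
  fixes f :: "nat \<Rightarrow> 'b::comm_monoid_add"
  shows "(\<Sum>i=1..7. f i) = f 1 + f 2 + f 3 + f 4 + f 5 + f 6 + f 7"
  unfolding index_set_7 by (simp add: add.assoc)

text \<open>
  The summands of the Ricci formula are symmetric, and for a bracket in strictly triangular form
  they vanish on the diagonal, which leaves the 21 pairs \<open>i < j\<close>.
\<close>

lemma symmetric_sum_7:
  fixes h :: "nat \<Rightarrow> nat \<Rightarrow> real"
  assumes diag: "\<And>i. i \<in> {1..7} \<Longrightarrow> h i i = 0" and sym: "\<And>i j. h i j = h j i"
  shows "(\<Sum>i=1..7. \<Sum>j=1..7. h i j) = 2 * (h 1 2 + h 1 3 + h 1 4 + h 1 5 + h 1 6 + h 1 7
    + h 2 3 + h 2 4 + h 2 5 + h 2 6 + h 2 7 + h 3 4 + h 3 5 + h 3 6 + h 3 7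
    + h 4 5 + h 4 6 + h 4 7 + h 5 6 + h 5 7 + h 6 7)"
  unfolding sum_7
    sym[of 2 1] sym[of 3 1] sym[of 4 1] sym[of 5 1] sym[of 6 1] sym[of 7 1]
    sym[of 3 2] sym[of 4 2] sym[of 5 2] sym[of 6 2] sym[of 7 2]
    sym[of 4 3] sym[of 5 3] sym[of 6 3] sym[of 7 3]
    sym[of 5 4] sym[of 6 4] sym[of 7 4] sym[of 6 5] sym[of 7 5] sym[of 7 6]
  using diag by (simp del: One_nat_def)

text \<open>
  The equations for \<open>dF\<^sup>1, \<dots>, dF\<^sup>7\<close>, written as values of \<open>F\<^sup>k\<close> on brackets; hence the signs.
\<close>

locale adapted_coframe =
  fixes br :: "'a::real_vector \<Rightarrow> 'a \<Rightarrow> 'a" and F :: "nat \<Rightarrow> 'a \<Rightarrow> real" and p q r t :: real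
  assumes bracket_1: "F 1 (br x y) = 0"
    and bracket_2: "F 2 (br x y) = 0"
    and bracket_3: "F 3 (br x y) = - wedge (F 1) (F 2) x y"
    and bracket_4: "F 4 (br x y) = - wedge (F 1) (F 3) x y"
    and bracket_5: "F 5 (br x y) = - wedge (F 1) (F 4) x y - p * wedge (F 1) (F 3) x y"
    and bracket_6: "F 6 (br x y) = - wedge (F 1) (F 5) x y - q * wedge (F 1) (F 4) x y
      - wedge (F 2) (F 3) x y"
    and bracket_7: "F 7 (br x y) = - wedge (F 1) (F 6) x y - r * wedge (F 1) (F 5) x y
      - t * wedge (F 2) (F 3) x y - wedge (F 2) (F 4) x y"
begin

lemmas brackets = bracket_1 bracket_2 bracket_3 bracket_4 bracket_5 bracket_6 bracket_7

lemma unimodular_adapted: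
  assumes "lie_algebra br" "dual_bases {1..7} F v"
  shows "trace_of (br x) = 0"
proof -
  interpret dual_bases "{1..7}" F v by fact
  have "linear (br x)" using assms(1) by (simp add: lie_algebra_def bilinear_def)
  then show ?thesis
    by (simp add: trace_of_eq_sum_dual sum_7 brackets wedge_def pairing del: One_nat_def)
qed

text \<open>
  A pair \<open>i < j\<close> contributes with a plus sign through the components of \<open>[v\<^sub>i,v\<^sub>j]\<close>, divided by
  \<open>w\<^sub>i w\<^sub>j\<close>, and with a minus sign through the \<open>v\<^sub>j\<close>-component of \<open>[x,v\<^sub>i]\<close>, with factor
  \<open>w\<^sub>j / w\<^sub>i\<close>. The \<open>v\<^sub>i\<close>-component of \<open>[x,v\<^sub>j]\<close> is zero since brackets only raise the index.
\<close>

lemma ricci_adapted: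
  assumes "orthogonal_lie_algebra {1..7} F v br w"
  shows "2 * ricci br (diagonal_metric {1..7} F w) x y =
    - (w 3 / w 2 + w 4 / w 3 + p\<^sup>2 * w 5 / w 3 + w 5 / w 4 + q\<^sup>2 * w 6 / w 4 + w 6 / w 5
        + r\<^sup>2 * w 7 / w 5 + w 7 / w 6) * (F 1 x * F 1 y)
    - (w 3 / w 1 + w 6 / w 3 + t\<^sup>2 * w 7 / w 3 + w 7 / w 4) * (F 2 x * F 2 y)
    + ((w 3)\<^sup>2 / (w 1 * w 2) - w 4 / w 1 - p\<^sup>2 * w 5 / w 1 - w 6 / w 2 - t\<^sup>2 * w 7 / w 2)
        * (F 3 x * F 3 y)
    + ((w 4)\<^sup>2 / (w 1 * w 3) - w 5 / w 1 - q\<^sup>2 * w 6 / w 1 - w 7 / w 2) * (F 4 x * F 4 y)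
    + (p\<^sup>2 * (w 5)\<^sup>2 / (w 1 * w 3) + (w 5)\<^sup>2 / (w 1 * w 4) - w 6 / w 1 - r\<^sup>2 * w 7 / w 1)
        * (F 5 x * F 5 y)
    + (q\<^sup>2 * (w 6)\<^sup>2 / (w 1 * w 4) + (w 6)\<^sup>2 / (w 1 * w 5) + (w 6)\<^sup>2 / (w 2 * w 3) - w 7 / w 1)
        * (F 6 x * F 6 y)
    + (r\<^sup>2 * (w 7)\<^sup>2 / (w 1 * w 5) + (w 7)\<^sup>2 / (w 1 * w 6) + t\<^sup>2 * (w 7)\<^sup>2 / (w 2 * w 3)
        + (w 7)\<^sup>2 / (w 2 * w 4)) * (F 7 x * F 7 y)
    - (p * w 5 / w 1 + t * w 7 / w 2) * (F 3 x * F 4 y + F 4 x * F 3 y)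
    + (p * w 4 * w 5 / (w 1 * w 3) - q * w 6 / w 1) * (F 4 x * F 5 y + F 5 x * F 4 y)
    + (q * w 5 * w 6 / (w 1 * w 4) - r * w 7 / w 1) * (F 5 x * F 6 y + F 6 x * F 5 y)
    + (r * w 6 * w 7 / (w 1 * w 5) + t * w 6 * w 7 / (w 2 * w 3)) * (F 6 x * F 7 y + F 7 x * F 6 y)"
proof -
  interpret orthogonal_lie_algebra "{1..7}" F v br w by fact
  have metric_at_basis: "diagonal_metric {1..7} F w u (v i) = w i * F i u" if "i \<in> {1..7}" for u i
    by (rule diagonal_metric_basis[OF that])
  have metric_expand: "diagonal_metric {1..7} F w u x = w 1 * F 1 u * F 1 x + w 2 * F 2 u * F 2 x
      + w 3 * F 3 u * F 3 x + w 4 * F 4 u * F 4 x + w 5 * F 5 u * F 5 x + w 6 * F 6 u * F 6 x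
      + w 7 * F 7 u * F 7 x" for u x
    by (simp add: diagonal_metric_def sum_7 del: One_nat_def)
  have nz: "w 1 \<noteq> 0" "w 2 \<noteq> 0" "w 3 \<noteq> 0" "w 4 \<noteq> 0" "w 5 \<noteq> 0" "w 6 \<noteq> 0" "w 7 \<noteq> 0"
    by (simp_all add: weight_nonzero)
  define h where "h i j = (g (br (v i) (v j)) x * g (br (v i) (v j)) y
      - (g (br x (v i)) (v j) + g (br x (v j)) (v i)) *
        (g (br y (v i)) (v j) + g (br y (v j)) (v i))) / (w i * w j)" for i j
  have "F i (br x (v i)) = 0" if "i \<in> {1..7}" for i x
    using that unfolding index_set_7
    by (auto simp: brackets wedge_def pairing simp del: One_nat_def)
  then have "h i i = 0" if "i \<in> {1..7}" for i
    using that bracket_self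
    by (simp add: h_def metric_at_basis bilinear_lzero[OF bilinear_metric] del: One_nat_def)
  moreover have "h i j = h j i" for i j
    using bracket_skew[of "v i" "v j"]
    by (simp add: h_def bilinear_lneg[OF bilinear_metric] add.commute mult.commute
        del: One_nat_def)
  ultimately have expand: "2 * ricci br g x y = h 1 2 + h 1 3 + h 1 4 + h 1 5 + h 1 6 + h 1 7
    + h 2 3 + h 2 4 + h 2 5 + h 2 6 + h 2 7 + h 3 4 + h 3 5 + h 3 6 + h 3 7
    + h 4 5 + h 4 6 + h 4 7 + h 5 6 + h 5 7 + h 6 7"
    unfolding ricci_orthogonal_basis h_def[symmetric]
    by (subst symmetric_sum_7) (auto simp del: One_nat_def)
  have hval:
    "h 1 2 = w 3 * F 3 x * w 3 * F 3 y / (w 1 * w 2)"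
    "h 1 3 = (w 4 * F 4 x + p * w 5 * F 5 x) * (w 4 * F 4 y + p * w 5 * F 5 y) / (w 1 * w 3)
      - w 3 / w 1 * (F 2 x * F 2 y)"
    "h 1 4 = (w 5 * F 5 x + q * w 6 * F 6 x) * (w 5 * F 5 y + q * w 6 * F 6 y) / (w 1 * w 4)
      - w 4 / w 1 * (F 3 x * F 3 y)"
    "h 1 5 = (w 6 * F 6 x + r * w 7 * F 7 x) * (w 6 * F 6 y + r * w 7 * F 7 y) / (w 1 * w 5)
      - w 5 / w 1 * ((F 4 x + p * F 3 x) * (F 4 y + p * F 3 y))"
    "h 1 6 = w 7 * F 7 x * w 7 * F 7 y / (w 1 * w 6)
      - w 6 / w 1 * ((F 5 x + q * F 4 x) * (F 5 y + q * F 4 y))"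
    "h 1 7 = - w 7 / w 1 * ((F 6 x + r * F 5 x) * (F 6 y + r * F 5 y))"
    "h 2 3 = (w 6 * F 6 x + t * w 7 * F 7 x) * (w 6 * F 6 y + t * w 7 * F 7 y) / (w 2 * w 3)
      - w 3 / w 2 * (F 1 x * F 1 y)"
    "h 2 4 = w 7 * F 7 x * w 7 * F 7 y / (w 2 * w 4)"
    "h 2 5 = 0"
    "h 2 6 = - w 6 / w 2 * (F 3 x * F 3 y)"
    "h 2 7 = - w 7 / w 2 * ((F 4 x + t * F 3 x) * (F 4 y + t * F 3 y))"
    "h 3 4 = - w 4 / w 3 * (F 1 x * F 1 y)"
    "h 3 5 = - w 5 / w 3 * ((p * F 1 x) * (p * F 1 y))"
    "h 3 6 = - w 6 / w 3 * (F 2 x * F 2 y)"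
    "h 3 7 = - w 7 / w 3 * ((t * F 2 x) * (t * F 2 y))"
    "h 4 5 = - w 5 / w 4 * (F 1 x * F 1 y)"
    "h 4 6 = - w 6 / w 4 * ((q * F 1 x) * (q * F 1 y))"
    "h 4 7 = - w 7 / w 4 * (F 2 x * F 2 y)"
    "h 5 6 = - w 6 / w 5 * (F 1 x * F 1 y)"
    "h 5 7 = - w 7 / w 5 * ((r * F 1 x) * (r * F 1 y))"
    "h 6 7 = - w 7 / w 6 * (F 1 x * F 1 y)"
    by (simp_all add: h_def metric_at_basis metric_expand brackets wedge_def pairing nz
        del: One_nat_def) (simp_all add: nz field_simps
        del: One_nat_def)
  show ?thesis
    unfolding expand hval
    by algebra
qed

end

text \<open>
  Starting with \<open>F\<^sup>5 = e\<^sup>5 + p e\<^sup>4\<close>, each later form is adjusted so that the prescribed \<open>dF\<^sup>k\<close>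
  comes out; in particular \<open>r p e\<^sup>5\<close> accounts for the term \<open>r p e\<^sup>1\<^sup>4\<close> of \<open>r F\<^sup>1\<^sup>5\<close>.
\<close>

definition sheared_coframe ::
    "real \<Rightarrow> real \<Rightarrow> real \<Rightarrow> (nat \<Rightarrow> 'a \<Rightarrow> real) \<Rightarrow> nat \<Rightarrow> 'a \<Rightarrow> real" where
  "sheared_coframe p q r e k x =
    (if k = 5 then e 5 x + p * e 4 x
     else if k = 6 then e 6 x + (p + q) * e 5 x
     else if k = 7 then e 7 x + (p + q + r) * e 6 x + r * p * e 5 x
     else e k x)"

lemma dual_space_basis_sheared:
  fixes e :: "nat \<Rightarrow> 'a::real_vector \<Rightarrow> real"
  assumes e: "dual_space_basis 7 e"
  shows "dual_space_basis 7 (sheared_coframe p q r e)"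
proof -
  let ?F = "sheared_coframe p q r e"
  have F: "(\<Sum>i=1..7. d i * ?F i x) = d 1 * e 1 x + d 2 * e 2 x + d 3 * e 3 x
      + (d 4 + p * d 5) * e 4 x + (d 5 + (p + q) * d 6 + r * p * d 7) * e 5 x
      + (d 6 + (p + q + r) * d 7) * e 6 x + d 7 * e 7 x" for d x
    by (simp add: sum_7 sheared_coframe_def algebra_simps del: One_nat_def)
  have lin: "linear (e i)" if "i \<in> {1, 2, 3, 4, 5, 6, 7}" for i
    using e that unfolding dual_space_basis_def index_set_7 by blast
  then have "linear (\<lambda>x. a * e i x)" if "i \<in> {1, 2, 3, 4, 5, 6, 7}" for a i
    using that linear_compose_scale_right[of "e i" a] by simp
  then have "linear (?F i)" if "i \<in> {1..7}" for i
    using that unfolding index_set_7 sheared_coframe_def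
    by (auto intro!: linear_compose_add simp: lin simp del: One_nat_def)
  moreover have "\<exists>d. \<alpha> = (\<lambda>x. \<Sum>i=1..7. d i * ?F i x)" if functional: "linear \<alpha>" for \<alpha> :: "'a \<Rightarrow> real"
  proof -
    obtain c where c: "\<alpha> = (\<lambda>x. \<Sum>i=1..7. c i * e i x)"
      using e functional unfolding dual_space_basis_def by blast
    \<comment> \<open>Solve the triangular system in \<open>F\<close> backwards from index 7.\<close>
    define d6 where "d6 = c 6 - (p + q + r) * c 7"
    define d5 where "d5 = c 5 - (p + q) * d6 - r * p * c 7"
    define d where "d i = (if i = 4 then c 4 - p * d5 else if i = 5 then d5
      else if i = 6 then d6 else c i)" for i :: nat
    have "\<alpha> = (\<lambda>x. \<Sum>i=1..7. d i * ?F i x)"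
      unfolding F c by (simp add: fun_eq_iff sum_7 d_def d5_def d6_def algebra_simps del: One_nat_def)
    then show ?thesis by blast
  qed
  moreover have "\<forall>i\<in>{1..7}. d i = 0" if "(\<lambda>x. \<Sum>i=1..7. d i * ?F i x) = (\<lambda>x. 0)" for d
  proof -
    define c where "c i = (if i = 4 then d 4 + p * d 5
      else if i = 5 then d 5 + (p + q) * d 6 + r * p * d 7
      else if i = 6 then d 6 + (p + q + r) * d 7 else d i)" for i :: nat
    have "(\<lambda>x. \<Sum>i=1..7. c i * e i x) = (\<lambda>x. 0)"
      using that unfolding F by (simp add: fun_eq_iff sum_7 c_def del: One_nat_def)
    then have "\<forall>i\<in>{1..7}. c i = 0"
      using e unfolding dual_space_basis_def by blast
    then show ?thesis
      unfolding index_set_7 by (auto simp: c_def simp del: One_nat_def)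
  qed
  ultimately show ?thesis
    unfolding dual_space_basis_def by blast
qed

lemma adapted_sheared_coframe:
  fixes br :: "'a::real_vector \<Rightarrow> 'a \<Rightarrow> 'a" and e :: "nat \<Rightarrow> 'a \<Rightarrow> real"
  assumes "ce_diff br (e 1) = (\<lambda>x y. 0)"
    and "ce_diff br (e 2) = (\<lambda>x y. 0)"
    and "ce_diff br (e 3) = wedge (e 1) (e 2)"
    and "ce_diff br (e 4) = wedge (e 1) (e 3)"
    and "ce_diff br (e 5) = wedge (e 1) (e 4)"
    and "ce_diff br (e 6) = (\<lambda>x y. wedge (e 1) (e 5) x y + wedge (e 2) (e 3) x y)"
    and "ce_diff br (e 7) =
      (\<lambda>x y. wedge (e 1) (e 6) x y + wedge (e 2) (e 3) x y + wedge (e 2) (e 4) x y)"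
  shows "adapted_coframe br (sheared_coframe p q r e) p q r (1 + p + q + r)"
proof -
  have br: "e i (br x y) = - ce_diff br (e i) x y" for i x y
    by (simp add: ce_diff_def)
  show ?thesis
    by unfold_locales
      (simp_all add: sheared_coframe_def br assms wedge_def algebra_simps del: One_nat_def)
qed

text \<open>
  The condition \<open>2 Ric = g\<close> for the metric with weights \<open>w\<close>, read off from the coefficients in
  \<open>ricci_adapted\<close>: first those of the seven squares, then those of the four mixed products.
\<close>

definition einstein_system :: "(nat \<Rightarrow> real) \<Rightarrow> real \<Rightarrow> real \<Rightarrow> real \<Rightarrow> real \<Rightarrow> bool" where
  "einstein_system w p q r t \<longleftrightarrow>
    w 3 / w 2 + w 4 / w 3 + p\<^sup>2 * w 5 / w 3 + w 5 / w 4 + q\<^sup>2 * w 6 / w 4 + w 6 / w 5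
      + r\<^sup>2 * w 7 / w 5 + w 7 / w 6 = - w 1 \<and>
    w 3 / w 1 + w 6 / w 3 + t\<^sup>2 * w 7 / w 3 + w 7 / w 4 = - w 2 \<and>
    (w 3)\<^sup>2 / (w 1 * w 2) - w 4 / w 1 - p\<^sup>2 * w 5 / w 1 - w 6 / w 2 - t\<^sup>2 * w 7 / w 2 = w 3 \<and>
    (w 4)\<^sup>2 / (w 1 * w 3) - w 5 / w 1 - q\<^sup>2 * w 6 / w 1 - w 7 / w 2 = w 4 \<and>
    p\<^sup>2 * (w 5)\<^sup>2 / (w 1 * w 3) + (w 5)\<^sup>2 / (w 1 * w 4) - w 6 / w 1 - r\<^sup>2 * w 7 / w 1 = w 5 \<and>
    q\<^sup>2 * (w 6)\<^sup>2 / (w 1 * w 4) + (w 6)\<^sup>2 / (w 1 * w 5) + (w 6)\<^sup>2 / (w 2 * w 3) - w 7 / w 1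
      = w 6 \<and>
    r\<^sup>2 * (w 7)\<^sup>2 / (w 1 * w 5) + (w 7)\<^sup>2 / (w 1 * w 6) + t\<^sup>2 * (w 7)\<^sup>2 / (w 2 * w 3)
      + (w 7)\<^sup>2 / (w 2 * w 4) = w 7 \<and>
    p * w 5 / w 1 + t * w 7 / w 2 = 0 \<and>
    p * w 4 * w 5 / (w 1 * w 3) = q * w 6 / w 1 \<and>
    q * w 5 * w 6 / (w 1 * w 4) = r * w 7 / w 1 \<and>
    r * w 6 * w 7 / (w 1 * w 5) + t * w 6 * w 7 / (w 2 * w 3) = 0"

lemma (in adapted_coframe) ricci_of_einstein_system:
  assumes "orthogonal_lie_algebra {1..7} F v br w" "einstein_system w p q r t"
  shows "2 * ricci br (diagonal_metric {1..7} F w) x y = diagonal_metric {1..7} F w x y"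
  unfolding ricci_adapted[OF assms(1)] diagonal_metric_def sum_7
  using assms(2) by (simp add: einstein_system_def del: One_nat_def)

text \<open>
  The equation of each square, divided by its right-hand side up to sign, is linear in the
  squared normalized structure constants
  \<open>c\<^sup>2 w\<^sub>k / (w\<^sub>i w\<^sub>j)\<close>, where \<open>c\<close> is the coefficient of \<open>F\<^sup>i\<^sup>j\<close> in \<open>dF\<^sup>k\<close>. With \<open>s = \<surd>399\<close> these take the
  values \<open>5\<close> for \<open>(12,3)\<close>; \<open>s - 27\<close> for \<open>(13,4)\<close> and \<open>(23,6)\<close>; \<open>-8\<close> for \<open>(14,5)\<close>, \<open>(16,7)\<close> and \<open>(24,7)\<close>;
  \<open>32 - 2s\<close> for \<open>(15,6)\<close>; \<open>29 - s\<close> for \<open>(13,5)\<close> and \<open>(23,7)\<close>; \<open>s - 12\<close> for \<open>(14,6)\<close> and \<open>(15,7)\<close>.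
  With these values, the seven square equations are identities in \<open>s\<close>. That the values come from actual
  \<open>w, p, q, r, t\<close>, and that the mixed terms vanish, is where \<open>s\<^sup>2 = 399\<close> is needed; there
  \<open>r = q\<close> and \<open>t = -p\<close>.
\<close>

lemma einstein_system_solvable:
  obtains w :: "nat \<Rightarrow> real" and p q r t :: real
  where "t = 1 + p + q + r" "\<And>i. i \<in> {1..7} \<Longrightarrow> w i \<noteq> 0" "einstein_system w p q r t"
proof -
  define s where "s = sqrt 399"
  have s2: "s * s = 399" by (simp add: s_def)
  have "19 < s" "s < 20"
    unfolding s_def by (simp_all add: real_less_rsqrt real_less_lsqrt)
  define p where "p = (s - 29) / 34"
  define q where "q = (12 - s) / 34"
  \<comment> \<open>The vanishing of the mixed term \<open>F\<^sup>4F\<^sup>5\<close> and \<open>t = -p\<close>, \<open>r = q\<close> fix \<open>p\<close> and \<open>q\<close>. Then the value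
    \<open>s - 12\<close> for \<open>(14,6)\<close> fixes \<open>W1\<close>, and the values for \<open>(15,6)\<close> and \<open>(23,6)\<close>, which give two
    expressions for \<open>W6\<close>, fix \<open>W2\<close>.\<close>
  define W1 where "W1 = 289 / (4 * ((s - 16) * (s - 12)))"
  define W2 where "W2 = 16 * (s - 16) * W1 ^ 3"
  define W3 where "W3 = 5 * W1 * W2"
  define W4 where "W4 = (s - 27) * W1 * W3"
  define W5 where "W5 = - 8 * W1 * W4"
  define W6 where "W6 = (32 - 2 * s) * W1 * W5"
  define W7 where "W7 = - 8 * W1 * W6"
  have nz: "W1 \<noteq> 0" "W2 \<noteq> 0" "W3 \<noteq> 0" "W4 \<noteq> 0" "W5 \<noteq> 0" "W6 \<noteq> 0" "W7 \<noteq> 0"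
    using \<open>19 < s\<close> \<open>s < 20\<close> by (simp_all add: W1_def W2_def W3_def W4_def W5_def W6_def W7_def)
  have W6': "W6 = (s - 27) * W2 * W3" and W7': "W7 = - 8 * W2 * W4"
    by (simp_all add: W7_def W6_def W5_def W4_def W2_def power3_eq_cube algebra_simps)
  have W1: "4 * ((s - 16) * (s - 12)) * W1 = 289"
  proof -
    have "4 * ((s - 16) * (s - 12)) \<noteq> 0" using \<open>19 < s\<close> by simp
    then show ?thesis
      unfolding W1_def by (simp only: times_divide_eq_right nonzero_mult_div_cancel_left simp_thms)
  qed
  have p2: "8 * (27 - s) * (p\<^sup>2 * W1) = 29 - s"
  proof -
    have "(29 - s) * (27 - s) = 2 * ((s - 16) * (s - 12))"
      using s2 by (simp add: algebra_simps)
    then have "8 * (27 - s) * (p\<^sup>2 * W1) = (29 - s) * (4 * ((s - 16) * (s - 12)) * W1) / 289"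
      unfolding p_def by (simp add: power2_eq_square field_simps)
    then show ?thesis unfolding W1 by simp
  qed
  have q2: "16 * (s - 16) * (q\<^sup>2 * W1) = s - 12"
  proof -
    have "16 * (s - 16) * (q\<^sup>2 * W1) = (s - 12) * (4 * ((s - 16) * (s - 12)) * W1) / 289"
      unfolding q_def by (simp add: power2_eq_square field_simps)
    then show ?thesis unfolding W1 by simp
  qed
  have pq: "p * (s - 27) = q * (32 - 2 * s)"
    unfolding p_def q_def using s2 by (simp add: field_simps)
  have pW5: "p\<^sup>2 * W5 = (29 - s) * W1 * W3"
    unfolding p2[symmetric] W5_def W4_def by (simp add: algebra_simps)
  have qW6: "q\<^sup>2 * W6 = (s - 12) * W1 * W4"
    unfolding q2[symmetric] W6_def W5_def by (simp add: algebra_simps)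
  have qW7: "q\<^sup>2 * W7 = (s - 12) * W1 * W5"
    unfolding q2[symmetric] W7_def W6_def by (simp add: algebra_simps)
  have pW7: "p\<^sup>2 * W7 = (29 - s) * W2 * W3"
    unfolding p2[symmetric] W7' W4_def by (simp add: algebra_simps)
  have ratio: "m * c / a = k * b \<and> m * c / b = k * a \<and> m * c\<^sup>2 / (a * b) = k * c"
    if "m * c = k * a * b" "a \<noteq> 0" "b \<noteq> 0" for m c k a b :: real
    unfolding power2_eq_square mult.assoc[symmetric] that(1) using that(2,3) by simp
  note ratios = ratio[of 1, simplified, OF W3_def nz(1,2)] ratio[of 1, simplified, OF W4_def nz(1,3)]
    ratio[of 1, simplified, OF W5_def nz(1,4)] ratio[of 1, simplified, OF W6_def nz(1,5)]
    ratio[of 1, simplified, OF W7_def nz(1,6)] ratio[of 1, simplified, OF W6' nz(2,3)]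
    ratio[of 1, simplified, OF W7' nz(2,4)] ratio[OF pW5 nz(1,3)] ratio[OF qW6 nz(1,4)]
    ratio[OF qW7 nz(1,5)] ratio[OF pW7 nz(2,3)]
  define w where "w i = (if i = 1 then W1 else if i = 2 then W2 else if i = 3 then W3
    else if i = 4 then W4 else if i = 5 then W5 else if i = 6 then W6 else W7)" for i :: nat
  have w: "w 1 = W1" "w 2 = W2" "w 3 = W3" "w 4 = W4" "w 5 = W5" "w 6 = W6" "w 7 = W7"
    by (simp_all add: w_def)
  have cross: "m * c * d / (a * b) = m * k * d \<and> m * c / a = m * k * b"
    if "c = k * a * b" "a \<noteq> 0" "b \<noteq> 0" for m c d k a b :: real
    using that by simp
  note mixed = cross[OF W4_def nz(1,3), of p W5] cross[OF W5_def nz(1,4), of p]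
    cross[OF W5_def nz(1,4), of q W6] cross[OF W6_def nz(1,5), of q W7]
    cross[OF W7_def nz(1,6), of q] cross[OF W6' nz(2,3), of p W7] cross[OF W7' nz(2,4), of p]
  have "einstein_system w p q q (- p)"
    unfolding einstein_system_def w
    by (simp only: power2_minus ratios mixed mult_minus_left minus_divide_left[symmetric] pq)
      (simp add: algebra_simps)
  then show ?thesis
  proof (rule that[rotated 2])
    show "- p = 1 + p + q + q" by (simp add: p_def q_def field_simps)
    show "w i \<noteq> 0" for i using nz by (simp add: w_def)
  qed
qed

theorem theorem2p2:
  fixes br :: "'g::real_vector \<Rightarrow> 'g \<Rightarrow> 'g"
    and e :: "nat \<Rightarrow> 'g \<Rightarrow> real"
  assumes "dim (UNIV :: 'g set) = 7"
    and "nilpotent_lie_algebra br"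
    and "dual_space_basis 7 e"
    and "ce_diff br (e 1) = (\<lambda>x y. 0)"
    and "ce_diff br (e 2) = (\<lambda>x y. 0)"
    and "ce_diff br (e 3) = wedge (e 1) (e 2)"
    and "ce_diff br (e 4) = wedge (e 1) (e 3)"
    and "ce_diff br (e 5) = wedge (e 1) (e 4)"
    and "ce_diff br (e 6) = (\<lambda>x y. wedge (e 1) (e 5) x y + wedge (e 2) (e 3) x y)"
    and "ce_diff br (e 7) =
      (\<lambda>x y. wedge (e 1) (e 6) x y + wedge (e 2) (e 3) x y + wedge (e 2) (e 4) x y)"
  shows "\<exists>g. pseudo_metric g \<and> einstein br g \<and> scalar_curvature br g \<noteq> 0"
proof -
  have lie: "lie_algebra br"
    using assms(2) by (simp add: nilpotent_lie_algebra_def)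
  obtain w p q r t where t: "t = 1 + p + q + r" and w: "\<And>i. i \<in> {1..7::nat} \<Longrightarrow> w i \<noteq> 0"
    and system: "einstein_system w p q r t"
    using einstein_system_solvable by metis
  define F where "F = sheared_coframe p q r e"
  define g where "g = diagonal_metric {1..7} F w"
  interpret adapted_coframe br F p q r t
    unfolding F_def t by (rule adapted_sheared_coframe[OF assms(4-10)])
  have dim: "dim (UNIV :: 'g set) > 0" using assms(1) by simp
  obtain v where v: "dual_bases {1..7} F v"
    using dual_basis_exists[OF dim dual_space_basis_sheared[OF assms(3)]] unfolding F_def by blast
  interpret dual_bases "{1..7}" F v by (rule v)
  have frame: "orthogonal_lie_algebra {1..7} F v br w"
    using dim lie w unimodular_adapted[OF lie v] by unfold_locales
  have metric: "pseudo_metric g"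
    unfolding g_def by (rule pseudo_metric_diagonal[OF w])
  have ricci: "ricci br g x y = 1 / 2 * g x y" for x y
    using ricci_of_einstein_system[OF frame system, of x y] by (simp add: g_def)
  have "scalar_curvature br g = 7 / 2"
    using scalar_curvature_einstein[OF metric ricci] assms(1) by simp
  then have "scalar_curvature br g \<noteq> 0" by simp
  moreover have "einstein br g"
    using ricci unfolding einstein_def by blast
  ultimately show ?thesis
    using metric by blast
qed

end
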